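(* Let $n\ge1$. In the boundary of the cone $C(S^1)^{(n)}_+$ of positive semidefinite $n\times n$ Toeplitz matrices, the stratification of the singular set of the hypersurface $H=\{T:\det T=0\}$ coincides with the stratification by the rank. More precisely, for any $m=0,\dots,n-1$, an element $T$ of the boundary of $C(S^1)^{(n)}_+$ has multiplicity (exactly) $m$ in $H$ if and only if $T$ has rank $n-m$.
   Context: Let $V=C(S^1)^{(n)}_h$ be the real vector space of self-adjoint $n\times n$ Toeplitz matrices $T=(t_{k-l})_{k,l}$, $t_{-j}=\overline{t_j}$; the cone $C(S^1)^{(n)}_+\subset V$ consists of the positive semidefinite ones, and its boundary is taken in $V$. For $k\ge1$ and $T,T_1,\dots,T_k\in V$ put $$D^{(k)}(\det)(T,T_1\otimes\cdots\otimes T_k)=\frac{\partial}{\partial t_1}\cdots\frac{\partial}{\partial t_k}\det(T+t_1T_1+\cdots+t_kT_k)\Big|_{t_1=\cdots=t_k=0},$$ a linear form on $V^{\otimes k}$, denoted $D^{(k)}\det(T)$. For $k\ge0$ let $$S_k=\{T\in V:\ D^{(k)}\det(T)=0,\ D^{(k-1)}\det(T)=0,\ \dots,\ \det(T)=0\},$$ so $\cdots\subset S_k\subset S_{k-1}\subset\cdots\subset S_0=H$. $T$ has multiplicity (exactly) $m\ge1$ if $T\in S_{m-1}\setminus S_m$, and multiplicity $0$ if $T\notin H$. *)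

theory Defs
  imports "HOL-Analysis.Analysis"
begin

text \<open>
  Matrices of size \<open>n = CARD('n)\<close> are indexed by an arbitrary nonempty finite linear order \<open>'n\<close>;
  \<open>idx i\<close> is the position of \<open>i\<close> in \<open>0, \<dots>, n - 1\<close>.
\<close>

definition idx :: "'n::{finite,linorder} \<Rightarrow> int" where
  "idx i = int (card {..<i})"

definition toeplitz_sa :: "(complex^'n::{finite,linorder}^'n::{finite,linorder}) set" where
  "toeplitz_sa = {T. \<exists>t :: int \<Rightarrow> complex.
     (\<forall>j. t (- j) = cnj (t j)) \<and> (\<forall>k l. T $ k $ l = t (idx k - idx l))}"

definition pos_semidef :: "complex^'n^'n \<Rightarrow> bool" where
  "pos_semidef A \<longleftrightarrow> (\<forall>x :: complex^'n.
     (\<Sum>i\<in>UNIV. \<Sum>j\<in>UNIV. cnj (x $ i) * A $ i $ j * x $ j) \<in> \<real> \<and>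
     0 \<le> Re (\<Sum>i\<in>UNIV. \<Sum>j\<in>UNIV. cnj (x $ i) * A $ i $ j * x $ j))"

definition toeplitz_pos :: "(complex^'n::{finite,linorder}^'n::{finite,linorder}) set" where
  "toeplitz_pos = {T \<in> toeplitz_sa. pos_semidef T}"

text \<open>The boundary is taken in the real vector space of self-adjoint Toeplitz matrices, not in
  the space of all matrices, where the cone has empty interior.\<close>

definition toeplitz_boundary :: "(complex^'n::{finite,linorder}^'n::{finite,linorder}) set" where
  "toeplitz_boundary = top_of_set toeplitz_sa frontier_of toeplitz_pos"

text \<open>The partial derivative in the \<open>i\<close>-th real variable of a function of real variables
  \<open>t 1, t 2, \<dots>\<close>.\<close>

definition partial_deriv ::
  "nat \<Rightarrow> ((nat \<Rightarrow> real) \<Rightarrow> complex) \<Rightarrow> (nat \<Rightarrow> real) \<Rightarrow> complex" where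
  "partial_deriv i g = (\<lambda>t. vector_derivative (\<lambda>s. g (t(i := s))) (at (t i)))"

text \<open>
  \<open>D_det k T U\<close> is the value of \<open>D^(k)(det)(T)\<close> on \<open>U 1 \<otimes> \<dots> \<otimes> U k\<close>. The determinant is complex-valued
  here (it is real on self-adjoint matrices). For \<open>k = 0\<close> this is \<open>det T\<close>. All functions being
  differentiated are polynomials in finitely many of the \<open>t i\<close>, so the derivatives exist.
\<close>

definition D_det :: "nat \<Rightarrow> complex^'n^'n \<Rightarrow> (nat \<Rightarrow> complex^'n^'n) \<Rightarrow> complex" where
  "D_det k T U =
     foldr partial_deriv [1..<k + 1] (\<lambda>t. det (T + (\<Sum>i = 1..k. t i *\<^sub>R U i))) (\<lambda>_. 0)"

text \<open>A linear form on the \<open>k\<close>-th tensor power vanishes iff it vanishes on all elementary tensors.\<close>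

definition D_det_vanishes :: "nat \<Rightarrow> complex^'n::{finite,linorder}^'n::{finite,linorder} \<Rightarrow> bool" where
  "D_det_vanishes k T \<longleftrightarrow> (\<forall>U. (\<forall>i\<in>{1..k}. U i \<in> toeplitz_sa) \<longrightarrow> D_det k T U = 0)"

definition det_hypersurface :: "(complex^'n::{finite,linorder}^'n::{finite,linorder}) set" where
  "det_hypersurface = {T \<in> toeplitz_sa. det T = 0}"

definition sing_stratum :: "nat \<Rightarrow> (complex^'n::{finite,linorder}^'n::{finite,linorder}) set" where
  "sing_stratum k = {T \<in> toeplitz_sa. \<forall>j\<le>k. D_det_vanishes j T}"

definition has_multiplicity :: "complex^'n::{finite,linorder}^'n::{finite,linorder} \<Rightarrow> nat \<Rightarrow> bool" where
  "has_multiplicity T m \<longleftrightarrow>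
     (if m = 0 then T \<notin> det_hypersurface
      else T \<in> sing_stratum (m - 1) - sing_stratum m)"

lemma sing_stratum_0: "sing_stratum 0 = det_hypersurface"
  by (auto simp: sing_stratum_def det_hypersurface_def D_det_vanishes_def D_det_def)

end

theory Submission
  imports Defs "HOL-Computational_Algebra.Polynomial"
begin

text \<open>
  Let \<open>T\<close> be Hermitian of rank \<open>r\<close> and \<open>d = n - r\<close>. Row operations by an invertible \<open>L\<close> turn \<open>d\<close> of
  the rows of \<open>T\<close> into zero rows, so \<open>det L * det (T + X) = det (L T + L X)\<close> vanishes to order \<open>d\<close>
  at \<open>X = 0\<close> and all derivatives of order less than \<open>d\<close> are zero. In the Toeplitz direction
  \<open>X = s I\<close> a factor \<open>s\<close> can be extracted from each of these \<open>d\<close> rows; the remaining factor is at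
  \<open>s = 0\<close> the determinant of the matrix whose rows are the other \<open>r\<close> rows of \<open>T\<close> and \<open>d\<close> rows of \<open>L\<close>
  in the left kernel of \<open>T\<close>. It is nonzero because \<open>x T T = 0\<close> implies \<open>x T = 0\<close> for Hermitian \<open>T\<close>.
  Hence the derivative of order \<open>d\<close> is nonzero.
\<close>

section \<open>Left kernels and row reduction of Hermitian matrices\<close>

lemma det_nonzero_if_left_kernel_trivial:
  fixes M :: "'a::field^'n^'n"
  assumes "\<And>x. x v* M = 0 \<Longrightarrow> x = 0"
  shows "det M \<noteq> 0"
proof -
  have "\<exists>N. N ** transpose M = mat 1"
    using assms by (simp add: matrix_left_invertible_ker)
  then have "invertible (transpose M)"
    by (simp add: invertible_left_inverse)
  then show ?thesis
    by (simp add: invertible_det_nz)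
qed

lemma vector_matrix_mult_eq_sum_rows: "x v* M = (\<Sum>i\<in>UNIV. x $ i *s M $ i)"
  by (simp add: vec_eq_iff vector_matrix_mult_def mult.commute)

text \<open>A basis chosen among the rows is pulled back to a set \<open>S\<close> of row indices,
  one index for each basis vector. Indices let later constructions treat rows in and outside
  \<open>S\<close> differently, even when \<open>T\<close> has repeated rows.\<close>

lemma row_basis:
  fixes T :: "'a::field^'n^'m"
  obtains S c where
    "card S = rank T"
    "\<And>j. T $ j = (\<Sum>i\<in>S. c j i *s T $ i)"
    "\<And>x i. (\<Sum>i\<in>S. x i *s T $ i) = 0 \<Longrightarrow> i \<in> S \<Longrightarrow> x i = 0"
proof -
  have rows: "rows T = range (($) T)"
    by (auto simp: rows_def row_def vec_lambda_eta)
  obtain B where B: "B \<subseteq> rows T" "vec.independent B" "rows T \<subseteq> vec.span B"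
      "card B = vec.dim (rows T)"
    using vec.basis_exists by blast
  obtain S where S: "inj_on (($) T) S" "B = ($) T ` S"
    using B(1) unfolding rows by (metis subset_image_inj)
  have fin: "finite S" "finite B" using S by auto
  have "\<exists>c. T $ j = (\<Sum>i\<in>S. c i *s T $ i)" for j
  proof -
    have "T $ j \<in> vec.span B" using B(3) rows by blast
    then obtain u where "T $ j = (\<Sum>v\<in>B. u v *s v)"
      using vec.span_finite[OF fin(2)] by auto
    also have "\<dots> = (\<Sum>i\<in>S. u (T $ i) *s T $ i)"
      unfolding S(2) by (simp add: sum.reindex[OF S(1)])
    finally show ?thesis by (rule exI[of _ "\<lambda>i. u (T $ i)"])
  qed
  then obtain c where c: "\<And>j. T $ j = (\<Sum>i\<in>S. c j i *s T $ i)" by metis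
  have indep: "x i = 0" if x: "(\<Sum>i\<in>S. x i *s T $ i) = 0" and i: "i \<in> S" for x i
  proof -
    define u where "u = x \<circ> inv_into S (($) T)"
    have u: "u (T $ i) = x i" if "i \<in> S" for i
      using that by (simp add: u_def inv_into_f_f[OF S(1)])
    have "(\<Sum>v\<in>B. u v *s v) = (\<Sum>i\<in>S. x i *s T $ i)"
      unfolding S(2) by (simp add: sum.reindex[OF S(1)] u)
    then have "u (T $ i) = 0"
      using vec.independentD[OF B(2) fin(2) order.refl, of u] x i S(2) by auto
    then show ?thesis using u i by simp
  qed
  have "card S = rank T"
    using B(4) card_image[OF S(1)] S(2) by (simp add: row_rank_def_gen)
  then show ?thesis by (rule that[of S c]) (fact c, fact indep)
qed

definition hermitian :: "complex^'n^'n \<Rightarrow> bool" where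
  "hermitian T \<longleftrightarrow> (\<forall>i j. T $ j $ i = cnj (T $ i $ j))"

text \<open>Since \<open>T\<close> equals its adjoint, the squared norm of \<open>x v* T\<close> is
  the product of \<open>(x v* T) v* T\<close> with the conjugate of \<open>x\<close>, hence
  zero.\<close>

lemma hermitian_left_kernel_square:
  assumes "hermitian T" "(x v* T) v* T = 0"
  shows "x v* T = 0"
proof -
  have T: "cnj (T $ i $ k) = T $ k $ i" for i k
    using assms(1) unfolding hermitian_def by metis
  define y where "y = x v* T"
  have "(\<Sum>k\<in>UNIV. y $ k * cnj (y $ k)) = (\<Sum>k\<in>UNIV. \<Sum>i\<in>UNIV. y $ k * (cnj (x $ i) * T $ k $ i))"
    by (intro sum.cong refl) (simp add: y_def vector_matrix_mult_def sum_distrib_left T)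
  also have "\<dots> = (\<Sum>i\<in>UNIV. cnj (x $ i) * (y v* T) $ i)"
    by (subst sum.swap) (simp add: vector_matrix_mult_def sum_distrib_left mult_ac)
  also have "\<dots> = 0" using assms(2) by (simp add: y_def)
  finally have "complex_of_real (\<Sum>k\<in>UNIV. (cmod (y $ k))\<^sup>2) = 0"
    by (simp only: complex_norm_square of_real_sum)
  then have "(\<Sum>k\<in>UNIV. (cmod (y $ k))\<^sup>2) = 0"
    by (simp only: of_real_eq_0_iff)
  then show ?thesis
    by (simp add: sum_nonneg_eq_0_iff vec_eq_iff y_def)
qed

text \<open>With d the corank, the last determinant divided by \<open>det L\<close> will turn out to
  be the coefficient of s^d in det (T + s I).\<close>

lemma hermitian_row_reduction:
  fixes T :: "complex^'n^'n"
  assumes herm: "hermitian T"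
  obtains S L where
    "card S = rank T"
    "det L \<noteq> 0"
    "\<And>j. (L ** T) $ j = (if j \<in> S then T $ j else 0)"
    "det (\<chi> j. if j \<in> S then T $ j else L $ j) \<noteq> 0"
proof -
  obtain S c where S: "card S = rank T"
    and c: "\<And>j. T $ j = (\<Sum>i\<in>S. c j i *s T $ i)"
    and indep: "\<And>x i. (\<Sum>i\<in>S. x i *s T $ i) = 0 \<Longrightarrow> i \<in> S \<Longrightarrow> x i = 0"
    by (rule row_basis[of T], rule that)
  \<comment> \<open>\<open>L\<close> subtracts from each row outside \<open>S\<close> its expansion in the rows of \<open>S\<close>.\<close>
  define L :: "complex^'n^'n" where
    "L = (\<chi> j k. (if j = k then 1 else 0) - (if j \<notin> S \<and> k \<in> S then c j k else 0))"
  have LT: "(L ** T) $ j = (if j \<in> S then T $ j else 0)" for j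
  proof -
    have "(L ** T) $ j = T $ j - (if j \<in> S then 0 else (\<Sum>i\<in>S. c j i *s T $ i))"
      by (auto simp: vec_eq_iff matrix_matrix_mult_def L_def left_diff_distrib sum_subtractf
          if_distrib[of "\<lambda>x. x * _"] sum.If_cases cong: if_cong)
    then show ?thesis by (simp flip: c)
  qed
  \<comment> \<open>If only the diagonal entry of column \<open>k\<close> contributes to coordinate
    \<open>k\<close> of \<open>x v* M\<close>, that coordinate is \<open>x $ k\<close>
    itself.\<close>
  have coord: "x $ k = 0"
    if "x v* M = 0" "M $ k $ k = 1" and off: "\<And>j. j \<noteq> k \<Longrightarrow> x $ j * M $ j $ k = 0"
    for x :: "complex^'n" and M :: "complex^'n^'n" and k
  proof -
    have "0 = (x v* M) $ k" using that by simp
    also have "\<dots> = (\<Sum>j\<in>UNIV. x $ j * M $ j $ k)"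
      by (simp add: vector_matrix_mult_def)
    also have "\<dots> = (\<Sum>j\<in>{k}. x $ j * M $ j $ k)"
      using off by (intro sum.mono_neutral_right) auto
    finally show ?thesis using that by simp
  qed
  have detL: "det L \<noteq> 0"
  proof (rule det_nonzero_if_left_kernel_trivial)
    fix x assume x: "x v* L = 0"
    \<comment> \<open>For \<open>k\<close> outside \<open>S\<close>, column \<open>k\<close> of
      \<open>L\<close> is a unit vector. Once these coordinates vanish, the entries
      \<open>- c j k\<close> in the columns of \<open>S\<close> contribute nothing.\<close>
    have out: "x $ k = 0" if "k \<notin> S" for k
      by (rule coord[OF x]) (use that in \<open>auto simp: L_def\<close>)
    have "x $ k = 0" if "k \<in> S" for k
      by (rule coord[OF x]) (use that out in \<open>auto simp: L_def\<close>)
    with out show "x = 0" by (auto simp: vec_eq_iff)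
  qed
  define M where "M = (\<chi> j. if j \<in> S then T $ j else L $ j)"
  have "det M \<noteq> 0"
  proof (rule det_nonzero_if_left_kernel_trivial)
    fix x assume x: "x v* M = 0"
    define y :: "complex^'n" where "y = (\<chi> j. if j \<in> S then x $ j else 0)"
    have yT: "y v* T = (\<Sum>i\<in>S. x $ i *s T $ i)"
      unfolding vector_matrix_mult_eq_sum_rows y_def
      by (rule sum.mono_neutral_cong_right) auto
    \<comment> \<open>The rows of \<open>L\<close> outside \<open>S\<close> lie in the left kernel
      of \<open>T\<close>. Multiplying \<open>x v* M = 0\<close> by \<open>T\<close> therefore
      leaves only the \<open>S\<close>-part \<open>y\<close> of \<open>x\<close>, with
      \<open>y v* (T ** T) = 0\<close>.\<close>
    have MT: "(M ** T) $ j = (if j \<in> S then (T ** T) $ j else 0)" for j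
      using LT[of j] by (auto simp: vec_eq_iff matrix_matrix_mult_def M_def)
    have "(y v* T) v* T = y v* (T ** T)"
      by (simp add: vector_matrix_mul_assoc)
    also have "\<dots> = x v* (M ** T)"
      unfolding vector_matrix_mult_eq_sum_rows MT
      by (rule sum.cong) (auto simp: y_def)
    also have "\<dots> = 0"
      using x by (simp flip: vector_matrix_mul_assoc)
    finally have "y v* T = 0"
      by (rule hermitian_left_kernel_square[OF herm])
    then have in_S: "x $ i = 0" if "i \<in> S" for i
      using indep[of "($) x" i] that by (simp add: yT)
    have "x $ k = 0" if "k \<notin> S" for k
      by (rule coord[OF x]) (use that in_S in \<open>auto simp: M_def L_def\<close>)
    with in_S show "x = 0" by (auto simp: vec_eq_iff)
  qed
  then show ?thesis
    using that[of S L] S detL LT by (simp add: M_def)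
qed

section \<open>Orders of vanishing under products and partial derivatives\<close>

text \<open>Polynomials in the variables \<open>t i\<close> all of whose monomials have degree at least \<open>k\<close>.\<close>

inductive vanishes_to_order :: "nat \<Rightarrow> ((nat \<Rightarrow> real) \<Rightarrow> complex) \<Rightarrow> bool" where
  const: "vanishes_to_order 0 (\<lambda>_. c)"
| zero: "vanishes_to_order k (\<lambda>_. 0)"
| var_mult: "vanishes_to_order k f \<Longrightarrow> vanishes_to_order (Suc k) (\<lambda>t. t i *\<^sub>R f t)"
| add: "vanishes_to_order k f \<Longrightarrow> vanishes_to_order k g \<Longrightarrow> vanishes_to_order k (\<lambda>t. f t + g t)"
| weaken: "vanishes_to_order (Suc k) f \<Longrightarrow> vanishes_to_order k f"

lemma vanishes_to_order_at_0:
  assumes "vanishes_to_order k f" "0 < k"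
  shows "f (\<lambda>_. 0) = 0"
  using assms by induction auto

lemma vanishes_to_order_sum:
  "(\<And>x. x \<in> A \<Longrightarrow> vanishes_to_order k (f x)) \<Longrightarrow> vanishes_to_order k (\<lambda>t. \<Sum>x\<in>A. f x t)"
  by (induction A rule: infinite_finite_induct)
     (auto intro: vanishes_to_order.zero vanishes_to_order.add)

lemma vanishes_to_order_cmult:
  assumes "vanishes_to_order k f"
  shows "vanishes_to_order k (\<lambda>t. c * f t)"
  using assms
proof induction
  case (var_mult k f i)
  from vanishes_to_order.var_mult[OF var_mult.IH] show ?case by simp
next
  case (add k f g)
  from vanishes_to_order.add[OF add.IH] show ?case by (simp add: distrib_left)
qed (simp_all add: vanishes_to_order.const vanishes_to_order.zero vanishes_to_order.weaken)

lemma vanishes_to_order_mult: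
  assumes "vanishes_to_order k f" "vanishes_to_order l g"
  shows "vanishes_to_order (k + l) (\<lambda>t. f t * g t)"
  using assms
proof induction
  case (const c)
  then show ?case by (simp add: vanishes_to_order_cmult)
next
  case (var_mult k f i)
  from vanishes_to_order.var_mult[OF var_mult.IH[OF var_mult.prems]] show ?case by simp
next
  case (add k f h)
  from vanishes_to_order.add[OF add.IH(1)[OF add.prems] add.IH(2)[OF add.prems]]
  show ?case by (simp add: distrib_right)
next
  case (weaken k f)
  from weaken.IH[OF weaken.prems] show ?case
    by (simp add: vanishes_to_order.weaken)
qed (simp add: vanishes_to_order.zero)

lemma vanishes_to_order_prod:
  assumes "\<And>x. x \<in> A \<Longrightarrow> vanishes_to_order (k x) (f x)"
  shows "vanishes_to_order (\<Sum>x\<in>A. k x) (\<lambda>t. \<Prod>x\<in>A. f x t)"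
  using assms
  by (induction A rule: infinite_finite_induct)
     (simp_all add: vanishes_to_order_mult vanishes_to_order.const)

text \<open>Each differentiation costs at most one order, by the product rule on monomials.
  Existence is carried through the induction because \<open>vector_derivative\<close> can be
  evaluated only where a derivative exists. At \<open>k = 0\<close> the truncated
  \<open>k - 1\<close> claims no vanishing.\<close>

lemma vanishes_to_order_has_derivative:
  assumes "vanishes_to_order k f"
  shows "\<exists>f'. vanishes_to_order (k - 1) f' \<and>
    (\<forall>t. ((\<lambda>s. f (t(i := s))) has_vector_derivative f' t) (at (t i)))"
  using assms
proof induction
  case (const c)
  show ?case by (rule exI[of _ "\<lambda>_. 0"]) (auto intro: vanishes_to_order.zero)
next
  case (zero k)
  show ?case by (rule exI[of _ "\<lambda>_. 0"]) (auto intro: vanishes_to_order.zero)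
next
  case (var_mult k f l)
  then obtain f' where f': "vanishes_to_order (k - 1) f'"
    "\<And>t. ((\<lambda>s. f (t(i := s))) has_vector_derivative f' t) (at (t i))" by blast
  \<comment> \<open>The factor \<open>t l\<close> restores the order lost in \<open>f'\<close>; for
    \<open>k = 0\<close> this gives order 1, which is weakened to 0.\<close>
  have "vanishes_to_order (Suc (k - 1)) (\<lambda>t. t l *\<^sub>R f' t)"
    by (rule vanishes_to_order.var_mult[OF f'(1)])
  then have *: "vanishes_to_order k (\<lambda>t. t l *\<^sub>R f' t)"
    by (cases k) (auto intro: vanishes_to_order.weaken)
  show ?case
  proof (cases "l = i")
    case True
    have "((\<lambda>s. s *\<^sub>R f (t(i := s))) has_vector_derivative (t i *\<^sub>R f' t + 1 *\<^sub>R f (t(i := t i)))) (at (t i))" for t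
      by (rule has_vector_derivative_scaleR[OF _ f'(2)]) (auto intro!: derivative_eq_intros)
    with True * var_mult.hyps show ?thesis
      by (intro exI[of _ "\<lambda>t. t l *\<^sub>R f' t + f t"]) (auto simp: fun_upd_def intro: vanishes_to_order.add)
  next
    case False
    have "((\<lambda>s. t l *\<^sub>R f (t(i := s))) has_vector_derivative t l *\<^sub>R f' t) (at (t i))" for t
      using f'(2) by (rule bounded_linear.has_vector_derivative[OF bounded_linear_scaleR_right])
    with False * show ?thesis
      by (intro exI[of _ "\<lambda>t. t l *\<^sub>R f' t"]) (auto simp: fun_upd_def)
  qed
next
  case (add k f g)
  then obtain f' g' where "vanishes_to_order (k - 1) f'" "vanishes_to_order (k - 1) g'"
    "\<And>t. ((\<lambda>s. f (t(i := s))) has_vector_derivative f' t) (at (t i))"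
    "\<And>t. ((\<lambda>s. g (t(i := s))) has_vector_derivative g' t) (at (t i))" by blast
  then show ?case
    by (intro exI[of _ "\<lambda>t. f' t + g' t"])
       (auto simp del: fun_upd_apply intro: vanishes_to_order.add has_vector_derivative_add)
next
  case (weaken k f)
  then show ?case
    by (cases k) (auto intro: vanishes_to_order.weaken)
qed

lemma vanishes_to_order_partial_deriv:
  assumes "vanishes_to_order k f"
  shows "vanishes_to_order (k - 1) (partial_deriv i f)"
proof -
  obtain f' where "vanishes_to_order (k - 1) f'"
    "\<And>t. ((\<lambda>s. f (t(i := s))) has_vector_derivative f' t) (at (t i))"
    using vanishes_to_order_has_derivative[OF assms] by blast
  moreover from this have "partial_deriv i f = f'"
    by (auto simp: partial_deriv_def fun_eq_iff intro: vector_derivative_at)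
  ultimately show ?thesis by simp
qed

lemma vanishes_to_order_iterated_partial_deriv:
  assumes "vanishes_to_order k f"
  shows "vanishes_to_order (k - length xs) (foldr partial_deriv xs f)"
proof (induction xs)
  case (Cons x xs)
  from vanishes_to_order_partial_deriv[OF this] show ?case by simp
qed (use assms in simp)

text \<open>A function of the sum of the variables has the same derivative in each of them, so every
  partial derivative acts as \<open>pderiv\<close>. This is the situation when all directions
  coincide.\<close>

lemma iterated_partial_deriv_poly_sum:
  assumes "set xs \<subseteq> A" "finite A"
  shows "foldr partial_deriv xs (\<lambda>t. poly P (of_real (\<Sum>i\<in>A. t i))) =
    (\<lambda>t. poly ((pderiv ^^ length xs) P) (of_real (\<Sum>i\<in>A. t i)))"
  using assms(1)
proof (induction xs)
  case (Cons x xs)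
  have x: "x \<in> A" using Cons.prems by simp
  have split: "(\<Sum>i\<in>A. (t(x := s)) i) = s + (\<Sum>i\<in>A - {x}. t i)" for t :: "nat \<Rightarrow> real" and s
    using assms(2) x by (simp add: sum.remove)
  have "((\<lambda>s. poly Q (of_real (\<Sum>i\<in>A. (t(x := s)) i))) has_vector_derivative
      poly (pderiv Q) (of_real (\<Sum>i\<in>A. t i))) (at (t x))" for t :: "nat \<Rightarrow> real" and Q :: "complex poly"
  proof -
    have eq: "(\<Sum>i\<in>A. t i) = t x + (\<Sum>i\<in>A - {x}. t i)"
      using split[of t "t x"] by simp
    have "((\<lambda>s. of_real (s + (\<Sum>i\<in>A - {x}. t i)) :: complex) has_vector_derivative 1) (at (t x))"
      by (auto intro!: derivative_eq_intros simp: has_vector_derivative_def scaleR_conv_of_real)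
    from field_vector_diff_chain_at[OF this poly_DERIV[of Q]] show ?thesis
      unfolding split eq by (simp add: o_def)
  qed
  then show ?case
    using Cons by (auto simp: partial_deriv_def fun_eq_iff intro!: vector_derivative_at)
qed simp

text \<open>In the Leibniz formula every factor is a polynomial of degree at most 1 in
  \<open>s\<close>.\<close>

lemma det_affine_is_poly:
  fixes A B :: "'a::{comm_ring_1,ring_char_0}^'n^'n"
  shows "\<exists>P. \<forall>s. det (\<chi> i. A $ i + s *s B $ i) = poly P s"
proof -
  have "\<forall>s. det (\<chi> i. A $ i + s *s B $ i) =
    poly (\<Sum>p | p permutes (UNIV :: 'n set). of_int (sign p) * (\<Prod>i\<in>UNIV. [: A $ i $ p i, B $ i $ p i :])) s"
    by (simp add: det_def poly_sum poly_prod poly_mult mult.commute)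
  then show ?thesis by blast
qed

section \<open>Derivatives of the determinant below and at the corank\<close>

text \<open>Each Leibniz term of \<open>det (L ** T + L ** X t)\<close> takes one entry from every
  row. The rows outside \<open>S\<close> have entries without constant term, so the order is at
  least the corank, and \<open>k\<close> derivatives leave it positive.\<close>

lemma D_det_eq_0_below_corank:
  fixes T :: "complex^'n^'n"
  assumes "hermitian T" "k < CARD('n) - rank T"
  shows "D_det k T U = 0"
proof -
  obtain S L where S: "card S = rank T" and L: "det L \<noteq> 0"
    and LT: "\<And>j. (L ** T) $ j = (if j \<in> S then T $ j else 0)"
    by (rule hermitian_row_reduction[OF assms(1)], rule that)
  define X where "X t = (\<Sum>i = 1..k. t i *\<^sub>R U i)" for t :: "nat \<Rightarrow> real"
  have X_lin: "vanishes_to_order 1 (\<lambda>t. (L ** X t) $ i $ j)" for i j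
  proof -
    have "vanishes_to_order 1 (\<lambda>t. \<Sum>l\<in>UNIV. L $ i $ l * (\<Sum>m = 1..k. t m *\<^sub>R U m $ l $ j))"
      using vanishes_to_order.var_mult[OF vanishes_to_order.const]
      by (intro vanishes_to_order_sum vanishes_to_order_cmult) simp
    then show ?thesis by (simp add: matrix_matrix_mult_def X_def)
  qed
  define ord where "ord i = (if i \<in> S then 0 else 1 :: nat)" for i
  have entry: "vanishes_to_order (ord i) (\<lambda>t. (L ** T + L ** X t) $ i $ j)" for i j
  proof (cases "i \<in> S")
    case True
    have "vanishes_to_order 0 (\<lambda>t. (L ** T) $ i $ j + (L ** X t) $ i $ j)"
      using X_lin by (auto intro!: vanishes_to_order.add vanishes_to_order.const intro: vanishes_to_order.weaken)
    with True show ?thesis by (simp add: ord_def)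
  next
    case False
    with X_lin[of i j] LT[of i] show ?thesis by (simp add: ord_def)
  qed
  have "sum ord UNIV = card (- S)"
    by (simp add: ord_def sum.If_cases)
  also have "\<dots> = CARD('n) - rank T"
    by (simp add: Compl_eq_Diff_UNIV card_Diff_subset S)
  finally have ord: "sum ord UNIV = CARD('n) - rank T" .
  have "vanishes_to_order (sum ord UNIV) (\<lambda>t. det (L ** T + L ** X t))"
    unfolding det_def
    by (intro vanishes_to_order_sum vanishes_to_order_cmult vanishes_to_order_prod entry)
  then have "vanishes_to_order (CARD('n) - rank T) (\<lambda>t. inverse (det L) * det (L ** T + L ** X t))"
    unfolding ord by (rule vanishes_to_order_cmult)
  also have "(\<lambda>t. inverse (det L) * det (L ** T + L ** X t)) = (\<lambda>t. det (T + X t))"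
    using L by (simp add: det_mul fun_eq_iff field_simps flip: matrix_add_ldistrib)
  finally have "vanishes_to_order (CARD('n) - rank T - length [1..<k + 1])
      (foldr partial_deriv [1..<k + 1] (\<lambda>t. det (T + X t)))"
    by (rule vanishes_to_order_iterated_partial_deriv)
  from vanishes_to_order_at_0[OF this] show ?thesis
    using assms(2) by (simp add: D_det_def X_def del: upt_Suc)
qed

text \<open>In the direction of the identity, the determinant is a one-variable polynomial
  \<open>P\<close> evaluated at the sum of the \<open>t i\<close>. The derivative is then d! times
  its coefficient of degree d, the corank.\<close>

lemma D_det_corank_identity:
  fixes T :: "complex^'n^'n"
  assumes "hermitian T"
  shows "D_det (CARD('n) - rank T) T (\<lambda>_. mat 1) \<noteq> 0"
proof -
  define d where "d = CARD('n) - rank T"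
  obtain S L where S: "card S = rank T" and L: "det L \<noteq> 0"
    and LT: "\<And>j. (L ** T) $ j = (if j \<in> S then T $ j else 0)"
    and M: "det (\<chi> j. if j \<in> S then T $ j else L $ j) \<noteq> 0"
    by (rule hermitian_row_reduction[OF assms], rule that)
  \<comment> \<open>\<open>A + s B\<close> is what remains of \<open>L ** (T + s I)\<close> after
    extracting \<open>s\<close> from the rows outside \<open>S\<close>: there the row of
    \<open>L\<close> is left, and in \<open>S\<close> the row of \<open>T\<close> plus
    \<open>s\<close> times that of \<open>L\<close>.\<close>
  define A where "A = (\<chi> j. if j \<in> S then T $ j else L $ j)"
  define B where "B = (\<chi> j. if j \<in> S then L $ j else 0)"
  obtain G where G: "\<And>s. det (\<chi> i. A $ i + s *s B $ i) = poly G s"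
    using det_affine_is_poly by blast
  define P where "P = smult (inverse (det L)) (monom 1 d * G)"
  have P: "det (T + r *\<^sub>R mat 1) = poly P (of_real r)" for r
  proof -
    define s where "s = complex_of_real r"
    have "det L * det (T + r *\<^sub>R mat 1) = det (L ** T + L ** (r *\<^sub>R mat 1))"
      by (simp add: det_mul flip: matrix_add_ldistrib)
    also have "L ** T + L ** (r *\<^sub>R mat 1) =
        (\<chi> i. (if i \<in> S then 1 else s) *s (A $ i + s *s B $ i))"
      using LT by (auto simp: vec_eq_iff A_def B_def s_def matrix_matrix_mult_def mat_def scaleR_conv_of_real[where 'a = complex]
          if_distrib[of "\<lambda>x. _ * x"] mult.commute cong: if_cong)
    also have "det \<dots> = (\<Prod>i\<in>UNIV. if i \<in> S then 1 else s) * poly G s"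
      by (simp only: det_rows_mul G)
    also have "(\<Prod>i\<in>UNIV. if i \<in> S then 1 else s) = s ^ d"
      by (simp add: prod.If_cases d_def Compl_eq_Diff_UNIV card_Diff_subset S)
    finally show ?thesis
      using L by (simp add: P_def poly_monom s_def field_simps)
  qed
  have "D_det d T (\<lambda>_. mat 1) = poly ((pderiv ^^ d) P) 0"
  proof -
    have "(\<lambda>t. det (T + (\<Sum>i = 1..d. t i *\<^sub>R mat 1))) = (\<lambda>t. poly P (of_real (\<Sum>i = 1..d. t i)))"
      by (simp add: P flip: scaleR_sum_left)
    moreover have "foldr partial_deriv [1..<d + 1] (\<lambda>t. poly P (of_real (\<Sum>i = 1..d. t i))) =
        (\<lambda>t. poly ((pderiv ^^ length [1..<d + 1]) P) (of_real (\<Sum>i = 1..d. t i)))"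
      by (rule iterated_partial_deriv_poly_sum) auto
    ultimately show ?thesis
      by (simp add: D_det_def del: upt_Suc)
  qed
  \<comment> \<open>\<open>pochhammer 1 d\<close> is d!, which is nonzero in the complex
    numbers.\<close>
  also have "\<dots> = pochhammer 1 d * coeff P d"
    by (simp add: poly_0_coeff_0 coeff_higher_pderiv)
  also have "coeff P d = inverse (det L) * coeff G 0"
    by (simp add: P_def coeff_monom_mult)
  also have "coeff G 0 = det A"
    using G[of 0] by (simp add: poly_0_coeff_0 vec_lambda_eta)
  finally show ?thesis
    using L M by (simp add: d_def A_def flip: pochhammer_fact)
qed

section \<open>Self-adjoint Toeplitz matrices and their strata\<close>

lemma rank_le_card: "rank (T :: 'a::field^'n^'m) \<le> CARD('m)"
proof -
  obtain S :: "'m set" where "card S = rank T" by (rule row_basis[of T], rule that)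
  then show ?thesis using card_mono[of UNIV S] by simp
qed

lemma toeplitz_sa_hermitian:
  fixes T :: "complex^'n::{finite,linorder}^'n::{finite,linorder}"
  assumes "T \<in> toeplitz_sa"
  shows "hermitian T"
proof -
  obtain t where t: "\<And>j. t (- j) = cnj (t j)" "\<And>k l. T $ k $ l = t (idx k - idx l)"
    using assms unfolding toeplitz_sa_def by blast
  have "t (idx j - idx i) = cnj (t (idx i - idx j))" for i j :: 'n
    using t(1)[of "idx i - idx j"] by simp
  then show ?thesis
    unfolding hermitian_def t(2) by blast
qed

text \<open>The number of predecessors is strictly increasing. Injectivity ensures that the symbol
  supported at 0 yields the identity matrix, so that the identity is an admissible
  direction.\<close>

lemma idx_eq_iff: "idx i = idx j \<longleftrightarrow> i = j"
proof -
  have "idx i < idx j" if "i < j" for i j :: 'a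
  proof -
    have "{..<i} \<subset> {..<j}" using that by force
    then show ?thesis by (simp add: idx_def psubset_card_mono)
  qed
  from this[of i j] this[of j i] show ?thesis by (cases i j rule: linorder_cases) auto
qed

lemma mat_1_in_toeplitz_sa: "mat 1 \<in> toeplitz_sa"
  unfolding toeplitz_sa_def
  by (auto intro!: exI[of _ "\<lambda>j. if j = 0 then 1 else 0"] simp: mat_def idx_eq_iff)

text \<open>The corank is the first order with a nonzero derivative, as witnessed by the identity
  direction; if it were at most \<open>k\<close>, it would be among the orders
  \<open>j\<close>.\<close>

lemma D_det_vanishes_below_iff:
  fixes T :: "complex^'n::{finite,linorder}^'n::{finite,linorder}"
  assumes "T \<in> toeplitz_sa"
  shows "(\<forall>j\<le>k. D_det_vanishes j T) \<longleftrightarrow> k < CARD('n) - rank T"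
proof
  assume *: "\<forall>j\<le>k. D_det_vanishes j T"
  have "\<not> D_det_vanishes (CARD('n) - rank T) T"
    using D_det_corank_identity[OF toeplitz_sa_hermitian[OF assms]] mat_1_in_toeplitz_sa
    unfolding D_det_vanishes_def by fast
  with * show "k < CARD('n) - rank T" by (meson not_le)
qed (auto simp: D_det_vanishes_def intro: D_det_eq_0_below_corank[OF toeplitz_sa_hermitian[OF assms]])

theorem theorem4p15:
  fixes T :: "complex^'n::{finite,linorder}^'n::{finite,linorder}" and m :: nat
  assumes "m \<in> {0..CARD('n) - 1}"
    and "T \<in> toeplitz_boundary"
  shows "has_multiplicity T m \<longleftrightarrow> rank T = CARD('n) - m"
proof -
  have T: "T \<in> toeplitz_sa"
    using assms(2) frontier_of_subset_topspace[of "top_of_set toeplitz_sa"]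
    by (auto simp: toeplitz_boundary_def)
  have strat: "T \<in> sing_stratum k \<longleftrightarrow> k < CARD('n) - rank T" for k
    using T by (simp add: sing_stratum_def D_det_vanishes_below_iff)
  have "m < CARD('n)"
    using assms(1) zero_less_card_finite[where 'a = 'n] by (simp del: zero_less_card_finite)
  then show ?thesis
    \<comment> \<open>The instance at 0 settles \<open>m = 0\<close>; those at \<open>m - 1\<close>
      and \<open>m\<close> force the corank to be exactly \<open>m\<close>. The bound on the rank
      makes the truncated subtraction a true one.\<close>
    using rank_le_card[of T] strat[of 0] strat[of "m - 1"] strat[of m]
    by (auto simp: has_multiplicity_def sing_stratum_0)
qed

end
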